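(* Let $q=2^m$ and let $y_1,\dots,y_{q+1}\in K$ and $H=\{y_i: 1\le i\le q+1\}\cup\{0\}$. Assume that for all $i\ne j$ there is no $v\in S$ with $\langle v,y_i\rangle=\langle v,y_j\rangle=0$ (i.e. no two points $y_i,y_j$ lie on a common line $\langle v,x\rangle=0$, $v\in S$). Then $H$ is a hyperoval if and only if $$\sum_{j=1}^{q+1}\langle y_i,y_j\rangle^k=0$$ for each $1\le i\le q+1$ and each $1\le k\le q$.
   Context: Let $q=2^m$, $F=\mathbb{F}_q$, $K=\mathbb{F}_{q^2}$, and for $x\in K$ write $\bar x=x^q$. Let $S=\{u\in K: u^{q+1}=1\}$ and define the $F$-valued bilinear form $\langle x,y\rangle=x\bar y+\bar x y$ on $K$. The affine plane $AG(2,q)$ is identified with $K$: its points are the elements of $K$ and its lines are the sets $L(u,\mu)=\{x\in K:\langle u,x\rangle+\mu=0\}$ with $u\in S$, $\mu\in F$. A hyperoval is a set of $q+2$ points of $K$, no three of which lie on a common line. *)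

theory Defs
  imports "HOL-Library.Cardinality"
begin

text \<open>
  The field with \<open>q\<^sup>2\<close> elements is a type \<open>'k\<close> of class \<open>field\<close> with \<open>CARD('k) = q\<^sup>2\<close>; its
  subfield with \<open>q\<close> elements is a set \<open>F :: 'k set\<close> with \<^term>\<open>card F = q\<close> that satisfies the
  following predicate.
\<close>

definition is_subfield :: "'k::field set \<Rightarrow> bool" where
  "is_subfield F \<longleftrightarrow>
     0 \<in> F \<and> 1 \<in> F \<and>
     (\<forall>x\<in>F. \<forall>y\<in>F. x + y \<in> F \<and> x * y \<in> F) \<and>
     (\<forall>x\<in>F. - x \<in> F \<and> inverse x \<in> F)"

definition conjg :: "nat \<Rightarrow> 'k::field \<Rightarrow> 'k" where
  "conjg q x = x ^ q"

definition unit_circle :: "nat \<Rightarrow> 'k::field set" where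
  "unit_circle q = {u. u ^ (q + 1) = 1}"

text \<open>The form takes its values in the subfield with \<open>q\<close> elements, but is typed with values in \<open>'k\<close>.\<close>

definition form :: "nat \<Rightarrow> 'k::field \<Rightarrow> 'k \<Rightarrow> 'k" where
  "form q x y = x * conjg q y + conjg q x * y"

definition affine_line :: "nat \<Rightarrow> 'k::field \<Rightarrow> 'k \<Rightarrow> 'k set" where
  "affine_line q u \<mu> = {x. form q u x + \<mu> = 0}"

definition affine_lines :: "nat \<Rightarrow> 'k::field set \<Rightarrow> 'k set set" where
  "affine_lines q F = {affine_line q u \<mu> | u \<mu>. u \<in> unit_circle q \<and> \<mu> \<in> F}"

definition hyperoval :: "nat \<Rightarrow> 'k::field set \<Rightarrow> 'k set \<Rightarrow> bool" where
  "hyperoval q F H \<longleftrightarrow>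
     card H = q + 2 \<and>
     (\<forall>T \<subseteq> H. card T = 3 \<longrightarrow> \<not> (\<exists>l \<in> affine_lines q F. T \<subseteq> l))"

end

theory Submission
  imports Defs "HOL-Computational_Algebra.Polynomial"
begin

text \<open>
  In characteristic two the form is alternating, and the hypothesis says that the points
  \<open>y\<^sub>i\<close> are nonzero with pairwise different directions; as there are \<open>q + 1\<close> of them, they
  represent all directions. Hence the lines that miss the origin are the level sets
  \<open>\<langle>y\<^sub>i, x\<rangle> = c\<close> with \<open>c \<noteq> 0\<close>, and each line through the origin contains exactly one \<open>y\<^sub>i\<close>.
  For fixed \<open>i\<close>, the power sums vanish iff every \<open>c \<noteq> 0\<close> is attained an even number of times
  by \<open>j \<mapsto> \<langle>y\<^sub>i, y\<^sub>j\<rangle>\<close>, because \<open>(x + c)\<^bsup>q-1\<^esup>\<close> is the indicator of \<open>x \<noteq> c\<close> on \<open>F\<close>. So the power sum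
  condition says that every line meets \<open>H\<close> in an even number of points. This is equivalent to
  \<open>H\<close> being a hyperoval: through a point of \<open>H\<close> pass \<open>q + 1\<close> lines, which distribute the
  \<open>q + 1\<close> other points of \<open>H\<close>.
\<close>

section \<open>Identities in finite fields\<close>

text \<open>Multiplication by \<open>x \<noteq> 0\<close> permutes \<open>F - {0}\<close>; comparing
  the products over this set gives \<open>x ^ (card F - 1) = 1\<close>.\<close>

lemma subfield_pow_card:
  fixes F :: "'k::{field,finite} set"
  assumes F: "is_subfield F" and x: "x \<in> F"
  shows "x ^ card F = x"
proof (cases "x = 0")
  case True
  with x show ?thesis by (auto simp: card_gt_0_iff)
next
  case False
  let ?G = "F - {0}"
  have z: "0 \<in> F" and "inverse x \<in> F" and mult: "\<And>a b. a \<in> F \<Longrightarrow> b \<in> F \<Longrightarrow> a * b \<in> F"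
    using F x by (auto simp: is_subfield_def)
  have "bij_betw ((*) x) ?G ?G"
    by (rule bij_betw_byWitness[where f' = "(*) (inverse x)"])
       (use False x \<open>inverse x \<in> F\<close> mult in auto)
  then have "(\<Prod>a\<in>?G. a) = (\<Prod>a\<in>?G. x * a)"
    by (rule prod.reindex_bij_betw[symmetric])
  also have "\<dots> = x ^ card ?G * (\<Prod>a\<in>?G. a)"
    by (simp add: prod.distrib)
  finally have "x ^ card ?G = 1"
    by simp
  then show ?thesis
    using card.remove[OF _ z] by simp
qed

lemma is_subfield_UNIV: "is_subfield UNIV"
  by (simp add: is_subfield_def)

text \<open>Translation by 1 leaves the sum over the field unchanged. This yields characteristic two
  once the cardinality is a power of 2.\<close>

lemma of_nat_CARD_eq_0: "(of_nat CARD('k) :: 'k::{field,finite}) = 0"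
proof -
  have "(\<Sum>x\<in>UNIV. x + 1 :: 'k) = (\<Sum>x\<in>UNIV. x)"
    by (rule sum.reindex_bij_betw) (rule bij_plus_right)
  then show ?thesis
    by (simp add: sum.distrib)
qed

lemma card_fixed_points_power_le:
  assumes "q > 1"
  shows "card {x :: 'k::field. x ^ q = x} \<le> q"
proof -
  let ?p = "monom 1 q - [:0, 1 :: 'k:]"
  have "coeff ?p q = 1"
    using assms by (cases q) (auto simp: coeff_pCons split: nat.splits)
  then have "?p \<noteq> 0" by (metis coeff_0 zero_neq_one)
  moreover have "degree ?p \<le> q"
    using assms by (intro degree_diff_le) (auto simp: degree_monom_le)
  ultimately have "card {x. poly ?p x = 0} \<le> q"
    using card_poly_roots_bound le_trans by blast
  then show ?thesis
    by (simp add: poly_monom)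
qed

section \<open>The alternating form on the quadratic extension\<close>

locale even_quadratic_extension =
  fixes m q :: nat and F :: "'k::{field,finite} set"
  assumes m: "m \<ge> 1" and q: "q = 2 ^ m"
    and card_K: "CARD('k) = q ^ 2"
    and F: "is_subfield F" and card_F: "card F = q"
begin

lemma q_gt_1: "q > 1"
  using m q by (metis not_one_le_zero one_less_numeral_iff one_less_power semiring_norm(76) zero_less_iff_neq_zero)

lemma even_q: "even q"
  using m q by simp

lemma two_eq_0: "(2 :: 'k) = 0"
  using of_nat_CARD_eq_0[where 'k='k] by (simp add: card_K q)

lemma add_self [simp]: "(x :: 'k) + x = 0"
  by (metis mult_2 mult_zero_left two_eq_0)

lemma add_eq_0_iff_eq: "(x :: 'k) + y = 0 \<longleftrightarrow> x = y"
  by (metis add_self add_left_cancel)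

lemma of_nat_eq_parity: "(of_nat n :: 'k) = (if even n then 0 else 1)"
  by (induction n) auto

lemma pow_q_add: "((x :: 'k) + y) ^ q = x ^ q + y ^ q"
proof -
  have "(x + y) ^ 2 ^ n = x ^ 2 ^ n + y ^ 2 ^ n" for n
  proof (induction n)
    case (Suc n)
    then show ?case
      by (simp add: power_mult mult.commute[of 2] power2_sum two_eq_0)
  qed simp
  then show ?thesis by (simp add: q)
qed

lemma pow_q_q: "((x :: 'k) ^ q) ^ q = x"
  using subfield_pow_card[OF is_subfield_UNIV, of x]
  by (simp add: card_K power2_eq_square power_mult)

text \<open>The elements of \<open>F\<close> are roots of X^q - X, which has at most
  \<open>q\<close> roots, so they are all of them.\<close>

lemma mem_F_iff: "x \<in> F \<longleftrightarrow> x ^ q = x"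
proof -
  have "F \<subseteq> {x. x ^ q = x}"
    using subfield_pow_card[OF F] card_F by auto
  then have "F = {x. x ^ q = x}"
    using card_fixed_points_power_le[OF q_gt_1, where 'k='k] card_F
    by (intro card_seteq) auto
  then show ?thesis by blast
qed

lemma form_eq: "form q x y = x * y ^ q + x ^ q * (y :: 'k)"
  by (simp add: form_def conjg_def)

lemma form_0 [simp]: "form q 0 (x :: 'k) = 0" "form q x (0 :: 'k) = 0"
  using q_gt_1 by (simp_all add: form_eq)

lemma form_self [simp]: "form q x (x :: 'k) = 0"
  by (simp add: form_eq mult.commute)

lemma form_commute: "form q x y = form q y (x :: 'k)"
  by (simp add: form_eq algebra_simps)

lemma form_add: "form q x (y + z) = form q x y + form q x (z :: 'k)"
  by (simp add: form_eq pow_q_add algebra_simps)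

lemma form_scale: "c \<in> F \<Longrightarrow> form q (c * x) y = c * form q x (y :: 'k)"
  by (simp add: form_eq mem_F_iff power_mult_distrib algebra_simps)

lemma form_mem_F: "form q x y \<in> F"
  by (simp add: mem_F_iff form_eq pow_q_add power_mult_distrib pow_q_q add.commute)

text \<open>In characteristic two \<open>y + z\<close> is also the difference, the direction of the
  line joining \<open>y\<close> and \<open>z\<close>.\<close>

lemma form_eq_iff: "form q x y = form q x z \<longleftrightarrow> form q x (y + z :: 'k) = 0"
  by (simp add: form_add add_eq_0_iff_eq)

text \<open>The linear relation between three vectors of a plane, with determinants as coefficients.\<close>
lemma form_plane_relation:
  "form q x y * z + form q y z * x + form q z x * (y :: 'k) = 0"
proof -
  have "form q x y * z + form q y z * x + form q z x * y =
      (x * y ^ q * z + x * y ^ q * z) + (x ^ q * y * z + x ^ q * y * z) + (x * y * z ^ q + x * y * z ^ q)"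
    unfolding form_eq by (simp only: algebra_simps)
  then show ?thesis by simp
qed

text \<open>The plane relation reduces to \<open>form q x y * z = 0\<close>. Orthogonality thus
  means equal direction, apart from the zero vector.\<close>

lemma form_eq_0_trans:
  assumes "form q x z = 0" "form q z y = 0" "z \<noteq> (0 :: 'k)"
  shows "form q x y = 0"
  using form_plane_relation[of x y z] assms by (simp add: form_commute)

text \<open>The norm of \<open>x\<close> lies in \<open>F\<close>, where every element is a square;
  dividing \<open>x\<close> by the root of its norm gives norm 1.\<close>

lemma normalize_to_unit_circle:
  assumes "x \<noteq> (0 :: 'k)"
  obtains s where "s \<in> F" "s \<noteq> 0" "s * x \<in> unit_circle q"
proof
  \<comment> \<open>\<open>N\<^bsup>q/2\<^esup>\<close> is the square root of \<open>N \<in> F\<close>.\<close>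
  define N where "N = x ^ (q + 1)"
  define s where "s = N ^ (q div 2)"
  have N: "N ^ q = N"
    by (simp add: N_def power_mult_distrib pow_q_q mult.commute)
  have "s ^ 2 = N"
    using even_q N by (simp add: s_def flip: power_mult)
  moreover have "s ^ q = s"
    by (metis N power_commutes power_mult mult.commute s_def)
  moreover have "N \<noteq> 0"
    using assms by (simp add: N_def)
  ultimately show "inverse s \<in> F" "inverse s \<noteq> 0" "inverse s * x \<in> unit_circle q"
    by (auto simp: mem_F_iff unit_circle_def power_mult_distrib power_inverse
        power2_eq_square N_def field_simps)
qed

text \<open>As the form is alternating, a normalized nonzero one among \<open>x\<close>,
  \<open>y\<close> serves as \<open>v\<close>, and \<open>v = 1\<close> if both vanish. The
  assumption on the points thus becomes \<open>form q (y i) (y j) \<noteq> 0\<close> for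
  \<open>i \<noteq> j\<close>.\<close>

lemma common_orthogonal:
  assumes "form q x y = 0"
  shows "\<exists>v\<in>unit_circle q. form q v x = 0 \<and> form q v (y :: 'k) = 0"
proof -
  have "\<exists>v\<in>unit_circle q. form q v x = 0 \<and> form q v y = 0"
    if "form q x y = 0" "x \<noteq> 0" for x y :: 'k
  proof -
    obtain s where "s \<in> F" "s * x \<in> unit_circle q"
      using normalize_to_unit_circle[OF \<open>x \<noteq> 0\<close>] by blast
    then show ?thesis
      using that by (intro bexI[of _ "s * x"]) (simp_all add: form_scale)
  qed
  from this[of x y] this[of y x] assms show ?thesis
    by (cases "x = 0"; cases "y = 0")
       (auto simp: form_commute unit_circle_def intro!: exI[of _ 1])
qed

lemma level_set_is_line:
  assumes "x \<noteq> (0 :: 'k)" "c \<in> F"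
  shows "{z. form q x z = c} \<in> affine_lines q F"
proof -
  obtain s where s: "s \<in> F" "s \<noteq> 0" "s * x \<in> unit_circle q"
    using normalize_to_unit_circle[OF \<open>x \<noteq> 0\<close>] by blast
  have "{z. form q x z = c} = affine_line q (s * x) (s * c)"
    using s by (simp add: affine_line_def form_scale add_eq_0_iff_eq)
  moreover have "s * c \<in> F"
    using s assms F by (simp add: is_subfield_def)
  ultimately show ?thesis
    using s by (auto simp: affine_lines_def)
qed

end

section \<open>Points representing all directions\<close>

locale punctured_hyperoval_candidate = even_quadratic_extension m q F
  for m q and F :: "'k::{field,finite} set" +
  fixes y :: "nat \<Rightarrow> 'k"
  assumes no_orthogonal: "\<And>i j. i \<in> {1..q + 1} \<Longrightarrow> j \<in> {1..q + 1} \<Longrightarrow> i \<noteq> j \<Longrightarrow>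
    \<not> (\<exists>v\<in>unit_circle q. form q v (y i) = 0 \<and> form q v (y j) = 0)"
begin

abbreviation I :: "nat set" where "I \<equiv> {1..q + 1}"

lemma form_eq_0_iff: "i \<in> I \<Longrightarrow> j \<in> I \<Longrightarrow> form q (y i) (y j) = 0 \<longleftrightarrow> i = j"
  using no_orthogonal common_orthogonal by (metis form_self)

lemma y_nonzero:
  assumes "i \<in> I"
  shows "y i \<noteq> 0"
proof
  assume "y i = 0"
  obtain j where "j \<in> I" "j \<noteq> i"
    using that[of 1] that[of 2] q_gt_1 by fastforce
  then show False
    using form_eq_0_iff[of i j] assms \<open>y i = 0\<close> by simp
qed

lemma inj_y: "inj_on y I"
  using form_eq_0_iff by (metis form_self inj_onI)

lemma eq_0_if_orthogonal_to_two:
  assumes "i \<in> I" "j \<in> I" "i \<noteq> j" "form q (y i) z = 0" "form q (y j) z = 0"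
  shows "z = 0"
  using assms form_eq_0_trans[of "y i" z "y j"] form_eq_0_iff form_commute by metis

text \<open>The products \<open>c * y i\<close> with \<open>c \<in> F - {0}\<close> are (q + 1)(q -
  1) = q^2 - 1 distinct nonzero elements, hence all of them.\<close>

lemma direction_represented:
  assumes "z \<noteq> 0"
  shows "\<exists>i\<in>I. form q (y i) z = 0"
proof -
  define f where "f = (\<lambda>(i, c). c * y i)"
  have "inj_on f (I \<times> (F - {0}))"
  proof (rule inj_onI)
    fix p r assume "p \<in> I \<times> (F - {0})" "r \<in> I \<times> (F - {0})" "f p = f r"
    moreover obtain i c where p: "p = (i, c)" by force
    moreover obtain j d where r: "r = (j, d)" by force
    ultimately have *: "i \<in> I" "j \<in> I" "c \<in> F" "d \<in> F" "c \<noteq> 0" "d \<noteq> 0"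
      and eq: "c * y i = d * y j"
      by (auto simp: f_def)
    \<comment> \<open>Pairing the equation with \<open>y j\<close> makes its right side
      vanish.\<close>
    have "c * form q (y i) (y j) = d * form q (y j) (y j)"
      using eq * by (metis form_scale)
    then have "i = j"
      using * form_eq_0_iff by simp
    with eq y_nonzero * show "p = r" by (simp add: p r)
  qed
  then have "card (f ` (I \<times> (F - {0}))) = (q + 1) * (q - 1)"
    using F card_F by (simp add: card_image card_cartesian_product is_subfield_def)
  also have "\<dots> = card (UNIV - {0 :: 'k})"
    by (simp add: card_K power2_eq_square algebra_simps)
  finally have "f ` (I \<times> (F - {0})) = UNIV - {0}"
    using y_nonzero by (intro card_seteq) (auto simp: f_def)
  then have "z \<in> f ` (I \<times> (F - {0}))"
    using assms by simp
  then obtain i c where "z = c * y i" "i \<in> I" "c \<in> F"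
    by (auto simp: f_def simp del: atLeastAtMost_iff)
  moreover from this have "form q (y i) z = 0"
    by (simp add: form_commute[of "y i"] form_scale)
  ultimately show ?thesis
    by blast
qed

section \<open>Power sums and parity of level sets\<close>

lemma power_sums_zero_iff_even:
  assumes i: "i \<in> I"
  shows "(\<forall>k\<in>{1..q}. (\<Sum>j\<in>I. form q (y i) (y j) ^ k) = 0) \<longleftrightarrow>
    (\<forall>c\<in>F - {0}. even (card {j \<in> I. form q (y i) (y j) = c}))"
proof -
  define a where "a = (\<lambda>j. form q (y i) (y j))"
  have a: "a j \<in> F" for j by (simp add: a_def form_mem_F)
  have "even (card {j \<in> I. a j = c})"
    if sums: "\<forall>k\<in>{1..q}. (\<Sum>j\<in>I. a j ^ k) = 0" and c: "c \<in> F" "c \<noteq> 0" for c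
  proof -
    have pow1: "x ^ (q - 1) = 1" if "x \<in> F" "x \<noteq> 0" for x
      using that q_gt_1 power_minus_mult[of q x] by (simp add: mem_F_iff)
    have "(\<Sum>j\<in>I. (a j + c) ^ (q - 1)) =
        (\<Sum>j\<in>I. \<Sum>k\<le>q - 1. of_nat ((q - 1) choose k) * a j ^ k * c ^ (q - 1 - k))"
      by (simp add: binomial_ring)
    also have "\<dots> = (\<Sum>k\<le>q - 1. of_nat ((q - 1) choose k) * c ^ (q - 1 - k) * (\<Sum>j\<in>I. a j ^ k))"
      by (subst sum.swap) (simp add: sum_distrib_left algebra_simps)
    \<comment> \<open>Only the term \<open>k = 0\<close> survives; its inner sum is
      \<open>card I = q + 1\<close>, which is odd.\<close>
    also have "\<dots> = (\<Sum>k\<in>{0}. of_nat ((q - 1) choose k) * c ^ (q - 1 - k) * (\<Sum>j\<in>I. a j ^ k))"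
      using sums by (intro sum.mono_neutral_right) auto
    also have "\<dots> = 1"
      using even_q pow1[OF c] by (simp add: of_nat_eq_parity)
    finally have 1: "(\<Sum>j\<in>I. (a j + c) ^ (q - 1)) = 1" .
    have "a j + c \<in> F" for j
      using a c F by (simp add: is_subfield_def)
    \<comment> \<open>The indicator of \<open>a j \<noteq> c\<close> is written as 1 plus the
      indicator of \<open>a j = c\<close>, so that the level set is counted.\<close>
    then have "(\<Sum>j\<in>I. (a j + c) ^ (q - 1)) = (\<Sum>j\<in>I. 1 + (if a j = c then 1 else 0))"
      using q_gt_1 by (intro sum.cong) (auto simp: pow1 add_eq_0_iff_eq simp del: One_nat_def)
    also have "\<dots> = of_nat (card I) + of_nat (card {j \<in> I. a j = c})"
      unfolding sum.distrib sum.inter_filter[OF finite_atLeastAtMost, symmetric] by simp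
    finally show ?thesis
      using 1 even_q by (simp add: of_nat_eq_parity split: if_splits)
  qed
  moreover have "(\<Sum>j\<in>I. a j ^ k) = 0"
    if ev: "\<forall>c\<in>F - {0}. even (card {j \<in> I. a j = c})" and k: "k \<in> {1..q}" for k
  proof -
    \<comment> \<open>Group by value: \<open>c = 0\<close> contributes nothing because
      \<open>k \<ge> 1\<close>, any other value an even multiple of \<open>c ^ k\<close>.\<close>
    have "(\<Sum>j\<in>I. a j ^ k) = (\<Sum>c\<in>F. \<Sum>j\<in>{j \<in> I. a j = c}. a j ^ k)"
      using a by (intro sum.group[symmetric]) auto
    also have "\<dots> = (\<Sum>c\<in>F. of_nat (card {j \<in> I. a j = c}) * c ^ k)"
      by simp
    also have "\<dots> = 0"
    proof (intro sum.neutral ballI)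
      fix c assume "c \<in> F"
      then show "of_nat (card {j \<in> I. a j = c}) * c ^ k = 0"
        using ev k by (cases "c = 0") (simp_all add: of_nat_eq_parity)
    qed
    finally show ?thesis .
  qed
  ultimately show ?thesis
    unfolding a_def by blast
qed

section \<open>Even intersections and hyperovals\<close>

text \<open>If the level set contains \<open>a\<close>, map each \<open>j \<noteq> a\<close> to the
  index \<open>\<tau> j\<close> of a normal of the line joining \<open>y a\<close> and
  \<open>y j\<close>. Without three collinear points \<open>\<tau>\<close> is injective, hence onto
  \<open>I - {a}\<close>; so \<open>i\<close> is attained, and the level set is a pair.\<close>

lemma even_if_hyperoval:
  assumes hyp: "hyperoval q F (y ` I \<union> {0})" and i: "i \<in> I" and c: "c \<noteq> 0"
  shows "even (card {j \<in> I. form q (y i) (y j) = c})"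
proof -
  have at_most_two: False
    if "l \<in> I" and "form q (y l) (y a) = d" "form q (y l) (y b) = d" "form q (y l) (y e) = d"
      and I: "a \<in> I" "b \<in> I" "e \<in> I" and ne: "a \<noteq> b" "a \<noteq> e" "b \<noteq> e" for l a b d e
  proof -
    have "card {y a, y b, y e} = 3"
      using ne inj_on_eq_iff[OF inj_y] I by simp
    moreover have "{z. form q (y l) z = d} \<in> affine_lines q F"
      using level_set_is_line y_nonzero form_mem_F that by blast
    moreover have "{y a, y b, y e} \<subseteq> {z. form q (y l) z = d}" "{y a, y b, y e} \<subseteq> y ` I \<union> {0}"
      using that by auto
    ultimately show False
      using hyp unfolding hyperoval_def by blast
  qed
  show ?thesis
  proof (cases "{j \<in> I. form q (y i) (y j) = c} = {}")
    case True
    then show ?thesis by (simp only: card.empty even_zero)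
  next
    case False
    then obtain a where a: "a \<in> I" "form q (y i) (y a) = c" by blast
    have "\<exists>l\<in>I - {a}. form q (y l) (y j + y a) = 0" if "j \<in> I - {a}" for j
    proof -
      have "y j + y a \<noteq> 0"
        using that a inj_on_eq_iff[OF inj_y] by (auto simp: add_eq_0_iff_eq simp del: atLeastAtMost_iff)
      then obtain l where "l \<in> I" "form q (y l) (y j + y a) = 0"
        using direction_represented by blast
      moreover from this have "l \<noteq> a"
        using that a form_eq_0_iff[of a j] by (auto simp: form_add)
      ultimately show ?thesis by blast
    qed
    then obtain \<tau> where \<tau>: "\<tau> j \<in> I - {a}" "form q (y (\<tau> j)) (y j + y a) = 0"
      if "j \<in> I - {a}" for j
      by metis
    have "inj_on \<tau> (I - {a})"
    proof (rule inj_onI, rule ccontr)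
      fix j j' assume "j \<in> I - {a}" "j' \<in> I - {a}" "\<tau> j = \<tau> j'" "j \<noteq> j'"
      then show False
        using at_most_two[of "\<tau> j" a _ j j'] \<tau>[of j] \<tau>[of j'] a form_eq_iff
        by (metis DiffE insertI1)
    qed
    then have "\<tau> ` (I - {a}) = I - {a}"
      using \<tau> by (intro endo_inj_surj image_subsetI) simp_all
    \<comment> \<open>For \<open>i = a\<close> the value \<open>c\<close> would be
      \<open>form q (y a) (y a) = 0\<close>.\<close>
    moreover have "i \<in> I - {a}"
      using i a c by auto
    ultimately have "i \<in> \<tau> ` (I - {a})"
      by (simp only:)
    then obtain b where b: "i = \<tau> b" "b \<in> I - {a}"
      by (rule imageE)
    have b_c: "form q (y i) (y b) = c"
      using \<tau>(2)[OF b(2)] a(2) form_eq_iff b(1) by metis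
    have eq: "{j \<in> I. form q (y i) (y j) = c} = {a, b}"
    proof (intro equalityI subsetI)
      fix e assume "e \<in> {j \<in> I. form q (y i) (y j) = c}"
      then have e: "e \<in> I" "form q (y i) (y e) = c" by simp_all
      show "e \<in> {a, b}"
      proof (rule ccontr)
        assume "e \<notin> {a, b}"
        then show False
          using at_most_two[OF i a(2) b_c e(2) a(1) _ e(1)] b(2) by simp
      qed
    next
      fix e assume "e \<in> {a, b}"
      then show "e \<in> {j \<in> I. form q (y i) (y j) = c}"
        using a b(2) b_c by (elim insertE) simp_all
    qed
    show ?thesis
      unfolding eq using b by simp
  qed
qed

text \<open>Conversely, evenness yields for each normal \<open>y i\<close>,
  \<open>i \<noteq> a\<close>, a second point \<open>y (\<sigma> i)\<close> on the line through
  \<open>y a\<close>. Here \<open>\<sigma>\<close> is a permutation of \<open>I - {a}\<close>, so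
  distinct points joined to \<open>y a\<close> have distinct normals, which excludes three collinear
  points.\<close>

lemma hyperoval_if_even:
  assumes ev: "\<And>i c. i \<in> I \<Longrightarrow> c \<in> F - {0} \<Longrightarrow> even (card {j \<in> I. form q (y i) (y j) = c})"
  shows "hyperoval q F (y ` I \<union> {0})"
proof -
  have "0 \<notin> y ` I"
    using y_nonzero by (metis imageE)
  then have card: "card (y ` I \<union> {0}) = q + 2"
    using card_image[OF inj_y] by simp
  have no_three: False
    if T: "T \<subseteq> y ` I \<union> {0}" "card T = 3" "T \<subseteq> affine_line q u \<mu>" and u: "u \<in> unit_circle q"
    for T u \<mu>
  proof -
    have line: "form q u t = \<mu>" if "t \<in> T" for t
      using T that by (auto simp: affine_line_def add_eq_0_iff_eq)
    have "u \<noteq> 0" using u by (auto simp: unit_circle_def)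
    have two: "j = k" if "j \<in> I" "k \<in> I" "form q u (y j) = 0" "form q u (y k) = 0" for j k
      using that no_orthogonal u by blast
    have "\<mu> \<noteq> 0"
    proof
      assume "\<mu> = 0"
      \<comment> \<open>A line through the origin would contain two of the points
        \<open>y i\<close>, contrary to \<open>two\<close>.\<close>
      have "card (T - {0}) \<ge> 2"
        using T(2) by (simp add: card_Diff_singleton_if)
      then obtain s t where "s \<in> T - {0}" "t \<in> T - {0}" "s \<noteq> t"
        by (metis card_le_Suc0_iff_eq finite numeral_2_eq_2 not_less_eq_eq)
      then show False
        using T(1) line \<open>\<mu> = 0\<close> two by blast
    qed
    then have "0 \<notin> T"
      using line by fastforce
    then have "T \<subseteq> y ` I" using T(1) by blast
    then obtain J where J: "J \<subseteq> I" "T = y ` J"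
      by (rule subset_imageE)
    then have "card J = 3"
      using T(2) inj_y by (metis card_image inj_on_subset)
    then obtain a b e where "J = {a, b, e}" and ne: "a \<noteq> b" "a \<noteq> e" "b \<noteq> e"
      by (auto simp: card_3_iff)
    with J have abe: "a \<in> I" "b \<in> I" "e \<in> I" "T = {y a, y b, y e}"
      by simp_all
    have "\<exists>j\<in>I - {a}. form q (y i) (y j + y a) = 0" if "i \<in> I - {a}" for i
    proof -
      let ?A = "{j \<in> I. form q (y i) (y j) = form q (y i) (y a)}"
      have "form q (y i) (y a) \<in> F - {0}"
        using that abe form_eq_0_iff form_mem_F by blast
      then have "even (card ?A)"
        using ev that by blast
      then have "?A \<noteq> {a}"
        by (metis One_nat_def card.empty card_insert_disjoint empty_iff finite.emptyI odd_one)
      then show ?thesis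
        using abe form_eq_iff by blast
    qed
    then obtain \<sigma> where \<sigma>: "\<sigma> i \<in> I - {a}" "form q (y i) (y (\<sigma> i) + y a) = 0"
      if "i \<in> I - {a}" for i
      by metis
    have nz: "y j + y a \<noteq> 0" if "j \<in> I - {a}" for j
      using that abe inj_on_eq_iff[OF inj_y] by (auto simp: add_eq_0_iff_eq simp del: atLeastAtMost_iff)
    \<comment> \<open>A nonzero vector is orthogonal to at most one \<open>y i\<close>.\<close>
    have "inj_on \<sigma> (I - {a})"
      using \<sigma> nz eq_0_if_orthogonal_to_two by (intro inj_onI) (metis DiffE)
    then have surj: "\<sigma> ` (I - {a}) = I - {a}"
      using \<sigma> by (intro endo_inj_surj image_subsetI) simp_all
    have "\<exists>i\<in>I - {a}. \<sigma> i = j \<and> form q u (y i) = 0" if "j \<in> {b, e}" for j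
    proof -
      have j: "j \<in> I - {a}" using that abe ne by blast
      then have "j \<in> \<sigma> ` (I - {a})" by (simp only: surj)
      then obtain i where i: "j = \<sigma> i" "i \<in> I - {a}" by (rule imageE)
      have "form q u (y j + y a) = 0"
        using that line abe form_eq_iff by blast
      \<comment> \<open>Both \<open>u\<close> and \<open>y i\<close> are orthogonal to the nonzero
        \<open>y j + y a\<close>. By \<open>two\<close>, the preimages of \<open>b\<close> and
        \<open>e\<close> under \<open>\<sigma>\<close> then coincide, although
        \<open>b \<noteq> e\<close>.\<close>
      then have "form q u (y i) = 0"
        using form_eq_0_trans[of u "y j + y a" "y i"] nz[OF j] \<sigma>[OF i(2)] i(1)
        by (simp add: form_commute)
      with i show ?thesis by blast
    qed
    then show False
      using two ne by (metis DiffE insertCI)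
  qed
  show ?thesis
    unfolding hyperoval_def
  proof (intro conjI allI impI notI card)
    fix T assume T: "T \<subseteq> y ` I \<union> {0}" "card T = 3" and "\<exists>l\<in>affine_lines q F. T \<subseteq> l"
    then obtain u \<mu> where "u \<in> unit_circle q" "T \<subseteq> affine_line q u \<mu>"
      unfolding affine_lines_def by blast
    with T show False
      by (intro no_three)
  qed
qed

end

theorem theorem6p1:
  fixes m q :: nat
    and F :: "'k::{field,finite} set"
    and y :: "nat \<Rightarrow> 'k"
    and H :: "'k set"
  assumes "m \<ge> 1" and "q = 2 ^ m"
    and "CARD('k) = q ^ 2"
    and "is_subfield F" and "card F = q"
    and "H = {y i | i. 1 \<le> i \<and> i \<le> q + 1} \<union> {0}"
    and "\<forall>i\<in>{1..q + 1}. \<forall>j\<in>{1..q + 1}. i \<noteq> j \<longrightarrow>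
           \<not> (\<exists>v \<in> unit_circle q. form q v (y i) = 0 \<and> form q v (y j) = 0)"
  shows "hyperoval q F H \<longleftrightarrow>
           (\<forall>i\<in>{1..q + 1}. \<forall>k\<in>{1..q}. (\<Sum>j = 1..q + 1. form q (y i) (y j) ^ k) = 0)"
proof -
  interpret punctured_hyperoval_candidate m q F y
    using assms(1-5,7) by unfold_locales blast+
  have "H = y ` I \<union> {0}"
    using assms(6) by auto
  moreover have "hyperoval q F (y ` I \<union> {0}) \<longleftrightarrow>
      (\<forall>i\<in>I. \<forall>c\<in>F - {0}. even (card {j \<in> I. form q (y i) (y j) = c}))"
  proof (intro iffI ballI)
    fix i c assume "hyperoval q F (y ` I \<union> {0})" "i \<in> I" "c \<in> F - {0}"
    then show "even (card {j \<in> I. form q (y i) (y j) = c})"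
      using even_if_hyperoval by blast
  next
    assume "\<forall>i\<in>I. \<forall>c\<in>F - {0}. even (card {j \<in> I. form q (y i) (y j) = c})"
    then show "hyperoval q F (y ` I \<union> {0})"
      by (intro hyperoval_if_even) blast
  qed
  ultimately show ?thesis
    by (simp only: power_sums_zero_iff_even cong: ball_cong)
qed

end
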